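(* Let $G$ be a full DAG with an ample framing $F$. Then the convex hull of the characteristic vectors of the exceptional routes of $F$ is a special simplex for the flow polytope $\mathcal{F}_1(G)$.
   Context: A DAG is a finite directed acyclic graph, possibly with multiple edges; sources have no incoming edges, sinks no outgoing edges, other vertices are inner; $\mathrm{in}(v),\mathrm{out}(v)$ are incoming/outgoing edges. $G$ is full if every inner vertex $v$ has $|\mathrm{in}(v)|=|\mathrm{out}(v)|=2$. A route is a maximal directed path (source to sink); its characteristic vector $v_R\in\mathbb{R}^{E(G)}$ is the indicator vector of its edges. The flow polytope $\mathcal{F}_1(G)\subset\mathbb{R}^{E(G)}$ is the set of nonnegative $f$ satisfying flow conservation at every inner vertex with total outflow from sources equal to $1$; its vertices are the $v_R$. A framing assigns to each inner vertex $v$ linear orders $\prec$ on $\mathrm{in}(v)$ and $\mathrm{out}(v)$. For inner $v$, paths in $\mathrm{Out}(v)$ (from $v$ to a sink) are compared by $P\prec Q$ iff at the last vertex $w$ of their common initial segment the edge of $P$ leaving $w$ precedes that of $Q$ in $\mathrm{out}(w)$; analogously for $\mathrm{In}(v)$ (paths from a source to $v$) at the first vertex of their common final segment using $\mathrm{in}(w)$. For a route $R$ through $v$, $Rv$, $vR$ are its parts before/after $v$. Routes $P,Q$ through a common inner vertex $v$ conflict at $v$ if, after possibly swapping them, $Pv\prec Qv$ and $vQ\prec vP$; coherent if no conflict at any common inner vertex. A route is exceptional if coherent with all routes. With $\mathcal{F}_+(G)$ the cone of nonnegative flows, a framing is ample if $\{v_R:R\text{ exceptional}\}$ lies in no facet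 of $\mathcal{F}_+(G)$ (equivalently, every non-idle edge lies on an exceptional route). For a lattice polytope $P$ (here Gorenstein), a simplex $S$ whose vertices are lattice points of $P$ is special if the intersection of every facet of $P$ with $S$ is a facet of $S$. *)

theory Defs
  imports "HOL-Analysis.Analysis" "Graph_Theory.Arc_Walk"
begin

text \<open>
  Graphs are multidigraphs \<^typ>\<open>('v, 'e) pre_digraph\<close> with arcs taken from a finite type. The arc set
  may be a proper subset of that type; the space of real functions on it is then the coordinate
  subspace of \<^typ>\<open>real ^ 'e\<close> of the vectors vanishing off \<^term>\<open>arcs G\<close>. Faces, affine dimension
  and simplices are insensitive to the ambient space.
\<close>

definition dag :: "('v, 'e) pre_digraph \<Rightarrow> bool" where
  "dag G \<longleftrightarrow> fin_digraph G \<and> (\<nexists>p. pre_digraph.cycle G p)"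

definition sources :: "('v, 'e) pre_digraph \<Rightarrow> 'v set" where
  "sources G = {v \<in> verts G. in_arcs G v = {}}"

definition sinks :: "('v, 'e) pre_digraph \<Rightarrow> 'v set" where
  "sinks G = {v \<in> verts G. out_arcs G v = {}}"

definition inner_verts :: "('v, 'e) pre_digraph \<Rightarrow> 'v set" where
  "inner_verts G = verts G - sources G - sinks G"

definition full_dag :: "('v, 'e) pre_digraph \<Rightarrow> bool" where
  "full_dag G \<longleftrightarrow> dag G \<and>
     (\<forall>v \<in> inner_verts G. card (in_arcs G v) = 2 \<and> card (out_arcs G v) = 2)"

text \<open>
  A route is the list of its arcs. It is nonempty: an isolated vertex, being both a source and a
  sink, carries no route (the zero vector is not a point of the flow polytope).
\<close>

definition route :: "('v, 'e) pre_digraph \<Rightarrow> 'e list \<Rightarrow> bool" where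
  "route G R \<longleftrightarrow> R \<noteq> [] \<and> (\<exists>s \<in> sources G. \<exists>t \<in> sinks G. pre_digraph.awalk G s R t)"

definition route_verts :: "('v, 'e) pre_digraph \<Rightarrow> 'e list \<Rightarrow> 'v set" where
  "route_verts G R = set (pre_digraph.awalk_verts G (tail G (hd R)) R)"

definition char_vec :: "'e list \<Rightarrow> real ^ 'e::finite" where
  "char_vec R = (\<chi> e. if e \<in> set R then 1 else 0)"

definition flow_cone :: "('v, 'e::finite) pre_digraph \<Rightarrow> (real ^ 'e) set" where
  "flow_cone G = {f. (\<forall>e \<in> arcs G. 0 \<le> f $ e) \<and> (\<forall>e. e \<notin> arcs G \<longrightarrow> f $ e = 0) \<and>
     (\<forall>v \<in> inner_verts G. (\<Sum>e \<in> in_arcs G v. f $ e) = (\<Sum>e \<in> out_arcs G v. f $ e))}"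

definition flow_polytope :: "('v, 'e::finite) pre_digraph \<Rightarrow> (real ^ 'e) set" where
  "flow_polytope G = {f \<in> flow_cone G. (\<Sum>v \<in> sources G. \<Sum>e \<in> out_arcs G v. f $ e) = 1}"

text \<open>The orders are strict: a pair \<^term>\<open>(d, e)\<close> in them means that \<^term>\<open>d\<close> precedes \<^term>\<open>e\<close>.\<close>

record ('v, 'e) framing =
  in_order :: "'v \<Rightarrow> 'e rel"
  out_order :: "'v \<Rightarrow> 'e rel"

definition is_framing :: "('v, 'e) pre_digraph \<Rightarrow> ('v, 'e) framing \<Rightarrow> bool" where
  "is_framing G F \<longleftrightarrow> (\<forall>v \<in> inner_verts G.
     in_order F v \<subseteq> in_arcs G v \<times> in_arcs G v \<and>
     strict_linear_order_on (in_arcs G v) (in_order F v) \<and>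
     out_order F v \<subseteq> out_arcs G v \<times> out_arcs G v \<and>
     strict_linear_order_on (out_arcs G v) (out_order F v))"

text \<open>
  The part of a route before, respectively after, an inner vertex \<^term>\<open>v\<close> on it: in an acyclic graph
  exactly one arc of the route leaves \<^term>\<open>v\<close>.
\<close>

definition route_before :: "('v, 'e) pre_digraph \<Rightarrow> 'e list \<Rightarrow> 'v \<Rightarrow> 'e list" where
  "route_before G R v = takeWhile (\<lambda>e. tail G e \<noteq> v) R"

definition route_after :: "('v, 'e) pre_digraph \<Rightarrow> 'e list \<Rightarrow> 'v \<Rightarrow> 'e list" where
  "route_after G R v = dropWhile (\<lambda>e. tail G e \<noteq> v) R"

text \<open>
  For paths \<^term>\<open>P\<close>, \<^term>\<open>Q\<close> from a common vertex to sinks, \<^term>\<open>C\<close> is the common initial segment and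
  \<^term>\<open>tail G d\<close> (which is also \<^term>\<open>tail G e\<close>) its last vertex; dually for paths from sources.
\<close>

definition out_less ::
    "('v, 'e) pre_digraph \<Rightarrow> ('v, 'e) framing \<Rightarrow> 'e list \<Rightarrow> 'e list \<Rightarrow> bool" where
  "out_less G F P Q \<longleftrightarrow> (\<exists>C d e P' Q'. P = C @ d # P' \<and> Q = C @ e # Q' \<and> d \<noteq> e \<and>
     (d, e) \<in> out_order F (tail G d))"

definition in_less ::
    "('v, 'e) pre_digraph \<Rightarrow> ('v, 'e) framing \<Rightarrow> 'e list \<Rightarrow> 'e list \<Rightarrow> bool" where
  "in_less G F P Q \<longleftrightarrow> (\<exists>C d e P' Q'. P = P' @ d # C \<and> Q = Q' @ e # C \<and> d \<noteq> e \<and>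
     (d, e) \<in> in_order F (head G d))"

definition conflict_at ::
    "('v, 'e) pre_digraph \<Rightarrow> ('v, 'e) framing \<Rightarrow> 'v \<Rightarrow> 'e list \<Rightarrow> 'e list \<Rightarrow> bool" where
  "conflict_at G F v P Q \<longleftrightarrow>
     in_less G F (route_before G P v) (route_before G Q v) \<and>
       out_less G F (route_after G Q v) (route_after G P v) \<or>
     in_less G F (route_before G Q v) (route_before G P v) \<and>
       out_less G F (route_after G P v) (route_after G Q v)"

definition coherent ::
    "('v, 'e) pre_digraph \<Rightarrow> ('v, 'e) framing \<Rightarrow> 'e list \<Rightarrow> 'e list \<Rightarrow> bool" where
  "coherent G F P Q \<longleftrightarrow>
     (\<forall>v \<in> inner_verts G \<inter> route_verts G P \<inter> route_verts G Q. \<not> conflict_at G F v P Q)"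

definition exceptional :: "('v, 'e) pre_digraph \<Rightarrow> ('v, 'e) framing \<Rightarrow> 'e list \<Rightarrow> bool" where
  "exceptional G F R \<longleftrightarrow> route G R \<and> (\<forall>Q. route G Q \<longrightarrow> coherent G F R Q)"

definition ample :: "('v, 'e::finite) pre_digraph \<Rightarrow> ('v, 'e) framing \<Rightarrow> bool" where
  "ample G F \<longleftrightarrow>
     \<not> (\<exists>X. X facet_of flow_cone G \<and> char_vec ` {R. exceptional G F R} \<subseteq> X)"

definition lattice_point :: "real ^ 'e::finite \<Rightarrow> bool" where
  "lattice_point x \<longleftrightarrow> (\<forall>i. x $ i \<in> \<int>)"

definition special_simplex :: "(real ^ 'e::finite) set \<Rightarrow> (real ^ 'e) set \<Rightarrow> bool" where
  "special_simplex P S \<longleftrightarrow> (\<exists>n. n simplex S) \<and>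
     (\<forall>x. x extreme_point_of S \<longrightarrow> x \<in> P \<and> lattice_point x) \<and>
     (\<forall>X. X facet_of P \<longrightarrow> (X \<inter> S) facet_of S)"

end

theory Submission
  imports Defs
begin

text \<open>
  At an inner vertex of a full DAG an exceptional route must go from the first incoming arc to the
  first outgoing one, or from the second to the second: otherwise it conflicts with a route through
  the two remaining arcs. Hence an exceptional route is determined by any one of its arcs, so that
  the exceptional routes are pairwise arc-disjoint. Their characteristic vectors are then orthogonal
  and span a simplex. By ampleness each arc lies on exactly one exceptional route. Every facet of the
  flow polytope is cut out by the vanishing of the flow on some arc, so it contains all vertices of
  the simplex except one.
\<close>

section \<open>Walks in acyclic digraphs\<close>

text \<open>Cutting at a named arc makes the endpoints of both pieces explicit as
  \<open>tail G d\<close> and \<open>head G d\<close>. This rewrite rule takes the place of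
  \<open>awalk_append_iff\<close>, which is removed from the simpset wherever it is used.\<close>

lemma (in wf_digraph) awalk_append_Cons_iff:
  "awalk u (A @ d # B) t \<longleftrightarrow> awalk u A (tail G d) \<and> d \<in> arcs G \<and> awalk (head G d) B t"
  by (induction A arbitrary: u) (auto simp: awalk_simps simp del: awalk_append_iff)

lemma inner_vertsI:
  assumes "wf_digraph G" "d \<in> in_arcs G v" "e \<in> out_arcs G v"
  shows "v \<in> inner_verts G"
  using assms wf_digraph.head_in_verts[of G d]
  unfolding inner_verts_def sources_def sinks_def by auto

locale acyclic_digraph = fin_digraph +
  assumes no_cycle: "\<not> cycle p"
begin

lemma closed_awalk_Nil: "awalk u p u \<Longrightarrow> p = []"
  using closed_w_imp_cycle[of p] no_cycle unfolding closed_w_def by blast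

text \<open>Otherwise the part of \<open>p\<close> from \<open>a\<close> on would be a nonempty
  closed walk. Dually, \<open>awalk_head_neq\<close> closes up the part ending in
  \<open>a\<close>.\<close>

lemma awalk_tail_neq:
  assumes "awalk u p v" "a \<in> set p"
  shows "tail G a \<noteq> v"
proof
  assume *: "tail G a = v"
  obtain A B where "p = A @ a # B" using assms(2) by (meson split_list)
  with assms(1) have "awalk (tail G a) (a # B) v"
    by (simp add: awalk_append_Cons_iff awalk_simps del: awalk_append_iff)
  with * show False using closed_awalk_Nil by blast
qed

lemma awalk_head_neq:
  assumes "awalk u p v" "a \<in> set p"
  shows "head G a \<noteq> u"
proof
  assume *: "head G a = u"
  obtain A B where p: "p = A @ a # B" using assms(2) by (meson split_list)
  with assms(1) have "awalk u A (tail G a)" "a \<in> arcs G"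
    by (simp_all add: awalk_append_Cons_iff del: awalk_append_iff)
  then have "awalk u (A @ [a]) (head G a)"
    by (simp add: awalk_append_Cons_iff awalk_simps del: awalk_append_iff)
  with * show False using closed_awalk_Nil by blast
qed

lemma awalk_distinct: "awalk u p v \<Longrightarrow> distinct p"
  by (induction p arbitrary: u) (auto simp: awalk_simps dest: awalk_head_neq)

lemma awalk_inj_on_head: "awalk u p v \<Longrightarrow> inj_on (head G) (set p)"
  by (induction p arbitrary: u) (auto simp: awalk_simps dest: awalk_head_neq)

text \<open>Heads lie below tails in the first relation, so induction along it follows arcs forward
  until a sink; the converse relation leads back to a source.\<close>

lemma wf_arcs: "wf ((\<lambda>e. (head G e, tail G e)) ` arcs G)" (is "wf ?r")
  and wf_arcs_converse: "wf ((\<lambda>e. (tail G e, head G e)) ` arcs G)" (is "wf ?s")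
proof -
  \<comment> \<open>The pairs are (head, tail), hence a chain from \<open>x\<close> to
    \<open>y\<close> is a walk in the opposite direction.\<close>
  have walk: "\<exists>p. p \<noteq> [] \<and> awalk y p x" if "(x, y) \<in> ?r\<^sup>+" for x y
    using that
  proof (induction rule: trancl_induct)
    case (base y)
    then show ?case using arc_implies_awalk by blast
  next
    case (step y z)
    then obtain p e where "p \<noteq> []" "awalk y p x" "e \<in> arcs G" "y = head G e" "z = tail G e"
      by auto
    then have "awalk z (e # p) x" by (simp add: awalk_simps)
    then show ?case by blast
  qed
  then have "acyclic ?r"
    using closed_awalk_Nil unfolding acyclic_def by blast
  moreover have "?s = ?r\<inverse>" by auto
  ultimately show "wf ?r" "wf ?s"
    by (simp_all add: finite_acyclic_wf finite_acyclic_wf_converse)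
qed

lemma awalk_to_sink:
  assumes "v \<in> verts G"
  shows "\<exists>p. \<exists>t \<in> sinks G. awalk v p t"
  using assms
proof (induction v rule: wf_induct_rule[OF wf_arcs])
  case (1 v)
  show ?case
  proof (cases "v \<in> sinks G")
    case True
    then show ?thesis using 1 awalk_Nil_iff by blast
  next
    case False
    then obtain e where e: "e \<in> arcs G" "tail G e = v"
      using 1 by (auto simp: sinks_def out_arcs_def)
    then obtain p t where "t \<in> sinks G" "awalk (head G e) p t"
      using 1 head_in_verts by blast
    then show ?thesis using e awalk_Cons_iff by blast
  qed
qed

lemma awalk_from_source:
  assumes "v \<in> verts G"
  shows "\<exists>p. \<exists>s \<in> sources G. awalk s p v"
  using assms
proof (induction v rule: wf_induct_rule[OF wf_arcs_converse])
  case (1 v)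
  show ?case
  proof (cases "v \<in> sources G")
    case True
    then show ?thesis using 1 awalk_Nil_iff by blast
  next
    case False
    then obtain e where e: "e \<in> arcs G" "head G e = v"
      using 1 by (auto simp: sources_def in_arcs_def)
    then obtain p s where "s \<in> sources G" "awalk s p (tail G e)"
      using 1 tail_in_verts by blast
    then have "awalk s (p @ [e]) v"
      using e arc_implies_awalk awalk_appendI by blast
    then show ?thesis using \<open>s \<in> sources G\<close> by blast
  qed
qed

section \<open>Routes through a vertex and their conflicts\<close>

lemma routeE:
  assumes "route G R"
  obtains s t where "s \<in> sources G" "t \<in> sinks G" "awalk s R t" "R \<noteq> []"
  using assms unfolding route_def by blast

text \<open>The tool for producing routes through a given arc or a given pair of consecutive arcs.
  The empty walk is excluded because at an isolated vertex it extends to no route.\<close>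

lemma awalk_extend_to_route:
  assumes "awalk u p v" "p \<noteq> []"
  shows "\<exists>A B. route G (A @ p @ B)"
proof -
  obtain A s B t where "s \<in> sources G" "awalk s A u" "t \<in> sinks G" "awalk v B t"
    using assms awalk_to_sink awalk_from_source awalk_hd_in_verts awalk_last_in_verts by meson
  then have "awalk s (A @ p @ B) t"
    using assms by (meson awalk_appendI)
  then show ?thesis
    using assms \<open>s \<in> sources G\<close> \<open>t \<in> sinks G\<close> unfolding route_def by blast
qed

lemma route_consecutive:
  assumes "route G (A @ d # e # B)"
  shows "d \<in> arcs G" "e \<in> arcs G" "tail G e = head G d" "head G d \<in> inner_verts G"
proof -
  show *: "d \<in> arcs G" "e \<in> arcs G" "tail G e = head G d"
    using assms by (auto elim!: routeE simp: awalk_append_Cons_iff awalk_simps simp del: awalk_append_iff)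
  then show "head G d \<in> inner_verts G"
    using inner_vertsI[OF wf_digraph_axioms, of d _ e] by simp
qed

lemma route_last:
  assumes "route G (A @ [d])"
  shows "head G d \<in> sinks G"
  using assms by (auto elim!: routeE simp: awalk_append_Cons_iff awalk_simps simp del: awalk_append_iff)

lemma route_hd:
  assumes "route G (d # B)"
  shows "tail G d \<in> sources G"
  using assms by (auto elim!: routeE simp: awalk_simps)

text \<open>By acyclicity no arc of \<open>A @ [d]\<close> leaves \<open>head G d\<close>, so
  \<open>takeWhile\<close> and \<open>dropWhile\<close> cut exactly in front of
  \<open>e\<close>.\<close>

lemma route_split_at:
  assumes "route G (A @ d # e # B)"
  shows "route_before G (A @ d # e # B) (head G d) = A @ [d]"
    and "route_after G (A @ d # e # B) (head G d) = e # B"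
    and "head G d \<in> route_verts G (A @ d # e # B)"
proof -
  obtain s t where w: "awalk s (A @ d # e # B) t"
    using assms by (rule routeE)
  have e: "tail G e = head G d"
    using route_consecutive[OF assms] by simp
  have "awalk s (A @ [d]) (head G d)"
    using w by (auto simp: awalk_append_Cons_iff awalk_simps simp del: awalk_append_iff)
  then have "\<forall>a \<in> set (A @ [d]). tail G a \<noteq> head G d"
    using awalk_tail_neq by blast
  with e show "route_before G (A @ d # e # B) (head G d) = A @ [d]"
    and "route_after G (A @ d # e # B) (head G d) = e # B"
    unfolding route_before_def route_after_def
    by (simp_all add: takeWhile_append dropWhile_append)
  show "head G d \<in> route_verts G (A @ d # e # B)"
    unfolding route_verts_def
    using awalk_verts_arc1[of e "A @ d # e # B" "tail G (hd (A @ d # e # B))"] e by simp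
qed

text \<open>The first route enters first and leaves second. Coherence is refuted for both orders of
  the pair, since it depends on the framing which of two given routes enters first.\<close>

lemma not_coherentI:
  assumes P: "route G (A @ d # e # B)" and Q: "route G (A' @ d' # e' # B')"
    and "head G d' = head G d" "(d, d') \<in> in_order F (head G d)"
    "(e', e) \<in> out_order F (head G d)" "d \<noteq> d'" "e \<noteq> e'"
  shows "\<not> coherent G F (A @ d # e # B) (A' @ d' # e' # B')"
    and "\<not> coherent G F (A' @ d' # e' # B') (A @ d # e # B)"
proof -
  let ?P = "A @ d # e # B" and ?Q = "A' @ d' # e' # B'" and ?v = "head G d"
  note Q' = route_split_at[OF Q, unfolded assms(3)]
  \<comment> \<open>The routes differ already in the arcs next to the vertex, so the common segments
    are empty.\<close>
  have "in_less G F (A @ [d]) (A' @ [d'])"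
    unfolding in_less_def using assms by blast
  moreover have "out_less G F (e' # B') (e # B)"
    unfolding out_less_def using assms route_consecutive[OF Q]
    by (metis append_Nil)
  ultimately have "conflict_at G F ?v ?P ?Q" "conflict_at G F ?v ?Q ?P"
    unfolding conflict_at_def by (simp_all add: route_split_at[OF P] Q')
  then show "\<not> coherent G F ?P ?Q" "\<not> coherent G F ?Q ?P"
    unfolding coherent_def
    using route_consecutive(4)[OF P] route_split_at(3)[OF P] Q'(3) by blast+
qed

end

lemma dag_imp_acyclic_digraph: "dag G \<Longrightarrow> acyclic_digraph G"
  unfolding dag_def acyclic_digraph_def acyclic_digraph_axioms_def by blast


section \<open>Exceptional routes of a full DAG\<close>

locale framed_full_dag = acyclic_digraph G for G :: "('v, 'e) pre_digraph" +
  fixes F :: "('v, 'e) framing"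
  assumes full: "v \<in> inner_verts G \<Longrightarrow> card (in_arcs G v) = 2 \<and> card (out_arcs G v) = 2"
    and framing: "is_framing G F"
begin

lemma in_order_total:
  assumes "v \<in> inner_verts G" "d \<in> in_arcs G v" "d' \<in> in_arcs G v" "d \<noteq> d'"
  shows "(d', d) \<in> in_order F v \<longleftrightarrow> (d, d') \<notin> in_order F v"
proof -
  have "strict_linear_order_on (in_arcs G v) (in_order F v)"
    using framing assms(1) unfolding is_framing_def by blast
  then show ?thesis
    using assms(2-) unfolding strict_linear_order_on_def total_on_def irrefl_def trans_def by metis
qed

lemma out_order_total:
  assumes "v \<in> inner_verts G" "d \<in> out_arcs G v" "d' \<in> out_arcs G v" "d \<noteq> d'"
  shows "(d', d) \<in> out_order F v \<longleftrightarrow> (d, d') \<notin> out_order F v"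
proof -
  have "strict_linear_order_on (out_arcs G v) (out_order F v)"
    using framing assms(1) unfolding is_framing_def by blast
  then show ?thesis
    using assms(2-) unfolding strict_linear_order_on_def total_on_def irrefl_def trans_def by metis
qed

text \<open>
  Otherwise the route would be in conflict with any route passing through the two other arcs
  \<^term>\<open>d'\<close> and \<^term>\<open>e'\<close>.
\<close>

lemma exceptional_passes_straight:
  assumes R: "exceptional G F (A @ d # e # B)"
    and d': "d' \<in> in_arcs G (head G d)" "d' \<noteq> d"
    and e': "e' \<in> out_arcs G (head G d)" "e' \<noteq> e"
  shows "(d, d') \<in> in_order F (head G d) \<longleftrightarrow> (e, e') \<in> out_order F (head G d)"
proof (rule ccontr)
  assume neq: "\<not> ?thesis"
  let ?v = "head G d"
  have route: "route G (A @ d # e # B)"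
    using R unfolding exceptional_def by blast
  note R' = route_consecutive[OF route]
  have "awalk (tail G d') [d', e'] (head G e')"
    using d' e' by (auto simp: awalk_simps)
  from awalk_extend_to_route[OF this] obtain A' B' where T: "route G (A' @ d' # e' # B')"
    by auto
  then have coh: "coherent G F (A @ d # e # B) (A' @ d' # e' # B')"
    using R unfolding exceptional_def by blast
  have order: "(d', d) \<in> in_order F ?v \<longleftrightarrow> (d, d') \<notin> in_order F ?v"
    "(e', e) \<in> out_order F ?v \<longleftrightarrow> (e, e') \<notin> out_order F ?v"
    using in_order_total[of ?v d d'] out_order_total[of ?v e e'] R' d' e' by auto
  have head: "head G d' = ?v" using d' by simp
  show False
  proof (cases "(d, d') \<in> in_order F ?v")
    case True
    then show False
      using not_coherentI(1)[OF route T head, of F] order neq coh d' e' by blast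
  next
    case False
    then show False
      using not_coherentI(2)[OF T route, of F] order neq coh d' e' unfolding head by auto
  qed
qed

section \<open>Exceptional routes through a common arc\<close>

lemma exceptional_next_unique:
  assumes "exceptional G F (A @ d # e # B)" "exceptional G F (A' @ d # e' # B')"
  shows "e = e'"
proof (rule ccontr)
  assume "e \<noteq> e'"
  let ?v = "head G d"
  have *: "?v \<in> inner_verts G" "d \<in> in_arcs G ?v" "e \<in> out_arcs G ?v" "e' \<in> out_arcs G ?v"
    using route_consecutive[of A d e B] route_consecutive[of A' d e' B'] assms
    unfolding exceptional_def by auto
  then obtain d' where d': "d' \<in> in_arcs G ?v" "d' \<noteq> d"
    using full[of ?v] by (metis card_2_iff')
  \<comment> \<open>\<open>e\<close> and \<open>e'\<close> are each other's alternative, so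
    \<open>(e, e')\<close> and \<open>(e', e)\<close> would each lie in the outgoing order exactly
    when \<open>(d, d')\<close> lies in the incoming one; but exactly one of the two does.\<close>
  show False
    using exceptional_passes_straight[OF assms(1) d', of e']
      exceptional_passes_straight[OF assms(2) d', of e] out_order_total[OF *(1,3,4)]
      * \<open>e \<noteq> e'\<close> by auto
qed

lemma exceptional_previous_unique:
  assumes "exceptional G F (A @ d # e # B)" "exceptional G F (A' @ d' # e # B')"
  shows "d = d'"
proof (rule ccontr)
  assume "d \<noteq> d'"
  let ?v = "head G d"
  have *: "?v \<in> inner_verts G" "d \<in> in_arcs G ?v" "d' \<in> in_arcs G ?v" "e \<in> out_arcs G ?v"
    "head G d' = ?v"
    using route_consecutive[of A d e B] route_consecutive[of A' d' e B'] assms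
    unfolding exceptional_def by auto
  then obtain e' where e': "e' \<in> out_arcs G ?v" "e' \<noteq> e"
    using full[of ?v] by (metis card_2_iff')
  show False
    using exceptional_passes_straight[OF assms(1), of d' e']
      exceptional_passes_straight[OF assms(2), of d e'] in_order_total[OF *(1,2,3)]
      * e' \<open>d \<noteq> d'\<close> by auto
qed

text \<open>Successors agree by \<open>exceptional_next_unique\<close>. If one route ends after
  \<open>d\<close>, then \<open>head G d\<close> is a sink, hence not inner, so the other ends there
  too. Arc and prefixes vary because the induction moves along the routes.\<close>

lemma exceptional_suffix_unique:
  assumes "exceptional G F (A @ d # B)" "exceptional G F (A' @ d # B')"
  shows "B = B'"
  using assms
proof (induction B arbitrary: A A' d B')
  case Nil
  then have sink: "head G d \<in> sinks G"
    using route_last unfolding exceptional_def by blast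
  show ?case
  proof (cases B')
    case (Cons e B'')
    then show ?thesis
      using route_consecutive[of A' d e B''] Nil sink
      unfolding exceptional_def inner_verts_def by auto
  qed simp
next
  case (Cons e B)
  show ?case
  proof (cases B')
    case Nil
    then have "head G d \<in> sinks G"
      using Cons.prems route_last unfolding exceptional_def by blast
    then show ?thesis
      using route_consecutive[of A d e B] Cons.prems
      unfolding exceptional_def inner_verts_def by auto
  next
    case (Cons e' B'')
    then have "e = e'"
      using exceptional_next_unique Cons.prems by blast
    then show ?thesis
      using Cons.IH[of "A @ [d]" e "A' @ [d]" B''] Cons.prems \<open>B' = e' # B''\<close> by simp
  qed
qed

text \<open>The mirror image, by induction from the end of the prefix: a route begins at a source,
  which is not inner, so neither route begins before the other.\<close>

lemma exceptional_prefix_unique: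
  assumes "exceptional G F (A @ d # B)" "exceptional G F (A' @ d # B')"
  shows "A = A'"
  using assms
proof (induction A arbitrary: B B' d A' rule: rev_induct)
  case Nil
  then have source: "tail G d \<in> sources G"
    using route_hd[of d B] unfolding exceptional_def by simp
  show ?case
  proof (cases A' rule: rev_cases)
    case (snoc A'' e)
    then show ?thesis
      using route_consecutive[of A'' e d B'] Nil source
      unfolding exceptional_def inner_verts_def by auto
  qed simp
next
  case (snoc e A)
  show ?case
  proof (cases A' rule: rev_cases)
    case Nil
    then have "tail G d \<in> sources G"
      using snoc.prems route_hd[of d B'] unfolding exceptional_def by simp
    then show ?thesis
      using route_consecutive[of A e d B] snoc.prems
      unfolding exceptional_def inner_verts_def by auto
  next
    case (snoc A'' e')
    then have "e = e'"
      using exceptional_previous_unique[of A e d B A'' e' B'] snoc.prems by simp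
    then show ?thesis
      using snoc.IH[of e "d # B" A'' "d # B'"] snoc.prems \<open>A' = A'' @ [e']\<close> by simp
  qed
qed

lemma exceptional_eqI:
  assumes "exceptional G F R" "exceptional G F R'" "e \<in> set R" "e \<in> set R'"
  shows "R = R'"
proof -
  obtain A B A' B' where "R = A @ e # B" "R' = A' @ e # B'"
    using assms(3,4) by (meson split_list)
  then show ?thesis
    using assms exceptional_suffix_unique exceptional_prefix_unique by blast
qed

text \<open>The vertex between two consecutive arcs has a second incoming arc, which the route
  misses because the arcs of a walk have distinct heads. Used to exclude a one-point simplex once
  the polytope has a facet.\<close>

lemma route_covering_arcs_singleton:
  assumes "route G R" "arcs G \<subseteq> set R"
  shows "\<exists>e. R = [e]"
proof (rule ccontr)
  assume "\<not> ?thesis"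
  moreover have "R \<noteq> []"
    using assms(1) unfolding route_def by blast
  ultimately obtain d e B where R: "R = d # e # B"
    by (metis list.exhaust)
  have *: "head G d \<in> inner_verts G" "d \<in> in_arcs G (head G d)"
    using route_consecutive[of "[]" d e B] assms(1) R by auto
  then obtain d' where d': "d' \<in> arcs G" "head G d' = head G d" "d' \<noteq> d"
    using full[of "head G d"] by (metis card_2_iff' in_in_arcs_conv)
  moreover have "inj_on (head G) (set R)"
    using assms(1) by (auto elim: routeE intro: awalk_inj_on_head)
  ultimately show False
    using assms(2) R by (metis inj_onD list.set_intros(1) subsetD)
qed

end

section \<open>The flow polytope\<close>

text \<open>Every arrival at \<open>v\<close> is matched by a departure, except at the two ends of
  the walk. The indicator terms make up for these, one on each side to avoid subtraction of
  naturals.\<close>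

lemma (in wf_digraph) awalk_balance:
  assumes "awalk u p w"
  shows "length (filter (\<lambda>e. head G e = v) p) + of_bool (u = v) =
    length (filter (\<lambda>e. tail G e = v) p) + of_bool (w = v)"
  using assms
proof (induction p arbitrary: u)
  case (Cons e p)
  then have "awalk (head G e) p w" "u = tail G e" by (simp_all add: awalk_Cons_iff)
  then show ?case using Cons.IH[of "head G e"] by auto
qed (simp add: awalk_simps)

lemma sum_char_vec: "(\<Sum>e \<in> A. char_vec R $ e) = real (card (A \<inter> set R))"
  unfolding char_vec_def by (simp add: sum.If_cases)

lemma char_vec_route_in_flow_polytope:
  fixes G :: "('v, 'e::finite) pre_digraph"
  assumes "dag G" "route G R"
  shows "char_vec R \<in> flow_polytope G"
proof -
  interpret acyclic_digraph G using dag_imp_acyclic_digraph[OF assms(1)] .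
  obtain s t where R: "s \<in> sources G" "t \<in> sinks G" "awalk s R t" "R \<noteq> []"
    using assms(2) by (rule routeE)
  have arcs: "set R \<subseteq> arcs G" using R(3) by blast
  \<comment> \<open>The arcs of a walk are distinct by acyclicity, so lengths of filtered lists are
    cardinalities.\<close>
  have count: "card (A \<inter> set R) = length (filter Q R)" if "\<And>e. e \<in> arcs G \<Longrightarrow> e \<in> A \<longleftrightarrow> Q e" for A Q
  proof -
    have "A \<inter> set R = set (filter Q R)" using arcs that by auto
    then show ?thesis using awalk_distinct[OF R(3)] by (metis distinct_card distinct_filter)
  qed
  have heads: "card (in_arcs G v \<inter> set R) = length (filter (\<lambda>e. head G e = v) R)" for v
    by (rule count) simp
  have tails: "card (out_arcs G v \<inter> set R) = length (filter (\<lambda>e. tail G e = v) R)" for v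
    by (rule count) simp
  have balance: "card (in_arcs G v \<inter> set R) + of_bool (s = v) =
      card (out_arcs G v \<inter> set R) + of_bool (t = v)" for v
    unfolding heads tails by (rule awalk_balance[OF R(3)])
  have "char_vec R \<in> flow_cone G"
    unfolding flow_cone_def
  proof (intro CollectI conjI ballI allI impI)
    fix v assume "v \<in> inner_verts G"
    then have "s \<noteq> v" "t \<noteq> v" using R unfolding inner_verts_def by auto
    then show "(\<Sum>e \<in> in_arcs G v. char_vec R $ e) = (\<Sum>e \<in> out_arcs G v. char_vec R $ e)"
      using balance[of v] by (simp add: sum_char_vec)
  qed (use arcs in \<open>auto simp: char_vec_def\<close>)
  moreover have "(\<Sum>v \<in> sources G. \<Sum>e \<in> out_arcs G v. char_vec R $ e) = 1"
  proof -
    \<comment> \<open>The end \<open>t\<close> is entered by the last arc, so it is no source; among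
      the sources only the start \<open>s\<close> then has outflow.\<close>
    obtain A a where A: "R = A @ [a]" using R(4) by (metis rev_exhaust)
    then have "t = head G a" "a \<in> arcs G"
      using R(3) by (auto simp: awalk_append_Cons_iff awalk_simps simp del: awalk_append_iff)
    then have "t \<notin> sources G" by (auto simp: sources_def)
    then have "card (out_arcs G v \<inter> set R) = of_bool (s = v)" if "v \<in> sources G" for v
      using balance[of v] that by (auto simp: sources_def)
    then have "(\<Sum>v \<in> sources G. \<Sum>e \<in> out_arcs G v. char_vec R $ e) =
        (\<Sum>v \<in> sources G. of_bool (s = v))"
      by (intro sum.cong) (auto simp: sum_char_vec)
    also have "\<dots> = 1"
      using R(1) by (simp add: of_bool_def sources_def)
    finally show ?thesis .
  qed
  ultimately show ?thesis unfolding flow_polytope_def by simp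
qed

section \<open>Faces and facets of the flow cone and the flow polytope\<close>

lemma polyhedron_flow_cone:
  fixes G :: "('v, 'e::finite) pre_digraph"
  assumes "fin_digraph G"
  shows "polyhedron (flow_cone G)"
proof -
  interpret fin_digraph G by fact
  \<comment> \<open>\<open>?c v\<close> is the normal vector of the hyperplane of conservation at
    \<open>v\<close>.\<close>
  let ?c = "\<lambda>v. (\<Sum>e \<in> in_arcs G v. axis e 1) - (\<Sum>e \<in> out_arcs G v. axis e 1) :: real ^ 'e"
  have "flow_cone G = (\<Inter>e \<in> arcs G. {f. axis e 1 \<bullet> f \<ge> 0}) \<inter>
      (\<Inter>e \<in> - arcs G. {f. axis e 1 \<bullet> f = 0}) \<inter> (\<Inter>v \<in> inner_verts G. {f. ?c v \<bullet> f = 0})"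
    unfolding flow_cone_def by (auto simp: inner_axis' inner_diff_left inner_sum_left)
  moreover have "finite (inner_verts G)"
    unfolding inner_verts_def by simp
  ultimately show ?thesis
    by (auto intro!: polyhedron_Int polyhedron_Inter polyhedron_halfspace_ge polyhedron_hyperplane)
qed

lemma convex_flow_polytope:
  fixes G :: "('v, 'e::finite) pre_digraph"
  assumes "fin_digraph G"
  shows "convex (flow_polytope G)"
proof -
  have "flow_polytope G =
      flow_cone G \<inter> {f. (\<Sum>v \<in> sources G. \<Sum>e \<in> out_arcs G v. axis e 1) \<bullet> f = 1}"
    unfolding flow_polytope_def by (auto simp: inner_axis' inner_sum_left)
  then show ?thesis
    using polyhedron_imp_convex[OF polyhedron_flow_cone[OF assms]]
    by (simp add: convex_Int convex_hyperplane)
qed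

lemma zero_coordinate_face_of:
  fixes S :: "(real ^ 'e::finite) set"
  assumes "convex S" "\<And>x. x \<in> S \<Longrightarrow> 0 \<le> x $ e"
  shows "(S \<inter> {x. x $ e = 0}) face_of S"
  using face_of_Int_supporting_hyperplane_ge[of S 0 "axis e 1"] assms by (simp add: inner_axis')

text \<open>The coefficients \<open>1 + c\<close> and \<open>- c\<close> add up to 1, so the linear
  equations persist; nonnegativity may fail and is assumed.\<close>

lemma flow_polytope_extrapolate:
  fixes G :: "('v, 'e::finite) pre_digraph"
  assumes "x \<in> flow_polytope G" "p \<in> flow_polytope G"
    and "\<And>e. e \<in> arcs G \<Longrightarrow> 0 \<le> (1 + c) * x $ e - c * p $ e"
  shows "(1 + c) *\<^sub>R x - c *\<^sub>R p \<in> flow_polytope G"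
  using assms unfolding flow_polytope_def flow_cone_def
  by (simp add: sum_subtractf flip: sum_distrib_left)

text \<open>A flow with full support lies in the relative interior of the flow polytope.\<close>

lemma face_of_flow_polytope_positive:
  fixes G :: "('v, 'e::finite) pre_digraph"
  assumes X: "X face_of flow_polytope G" and x: "x \<in> X" "\<And>e. e \<in> arcs G \<Longrightarrow> 0 < x $ e"
  shows "X = flow_polytope G"
proof
  show "X \<subseteq> flow_polytope G" using X by (rule face_of_imp_subset)
  show "flow_polytope G \<subseteq> X"
  proof
    fix p assume p: "p \<in> flow_polytope G"
    have xP: "x \<in> flow_polytope G" using X x(1) face_of_imp_subset by blast
    \<comment> \<open>The inserted 1 keeps the minimum defined if there are no arcs.\<close>
    define m where "m = Min (insert 1 ((\<lambda>e. x $ e) ` arcs G))"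
    have m: "m > 0" "\<And>e. e \<in> arcs G \<Longrightarrow> m \<le> x $ e"
      unfolding m_def using x(2) by auto
    define b where "b = 1 + (\<Sum>e \<in> arcs G. p $ e)"
    have nonneg: "\<And>e. e \<in> arcs G \<Longrightarrow> 0 \<le> p $ e"
      using p unfolding flow_polytope_def flow_cone_def by blast
    have b: "b > 0" "\<And>e. e \<in> arcs G \<Longrightarrow> p $ e \<le> b"
    proof -
      show "b > 0" unfolding b_def using nonneg by (simp add: add_pos_nonneg sum_nonneg)
      show "p $ e \<le> b" if "e \<in> arcs G" for e
        using member_le_sum[of e "arcs G" "\<lambda>e. p $ e"] nonneg that unfolding b_def by force
    qed
    \<comment> \<open>With this step length \<open>c * p $ e\<close> is at most \<open>m\<close>, so
      \<open>x\<close> can be pushed away from \<open>p\<close>, to \<open>q\<close>, within the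
      polytope.\<close>
    define c where "c = m / b"
    have c: "c > 0" unfolding c_def using m b by simp
    define q where "q = (1 + c) *\<^sub>R x - c *\<^sub>R p"
    have "0 \<le> (1 + c) * x $ e - c * p $ e" if "e \<in> arcs G" for e
    proof -
      have "c * p $ e \<le> c * b" using b(2)[OF that] c by simp
      also have "\<dots> = m" unfolding c_def using b by simp
      also have "\<dots> \<le> x $ e" using m that by simp
      also have "\<dots> \<le> (1 + c) * x $ e" using c x(2)[OF that] by (simp add: algebra_simps)
      finally show ?thesis by simp
    qed
    then have q: "q \<in> flow_polytope G"
      unfolding q_def using xP p by (intro flow_polytope_extrapolate)
    have x_eq: "x = (1 - 1 / (1 + c)) *\<^sub>R p + (1 / (1 + c)) *\<^sub>R q"
    proof -
      have "(1 + c) *\<^sub>R x = c *\<^sub>R p + q" unfolding q_def by simp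
      then have "x = (1 / (1 + c)) *\<^sub>R (c *\<^sub>R p + q)"
        using c by (metis add_pos_pos divide_self_if less_numeral_extra(1,3) real_vector.scale_one
            scaleR_scaleR times_divide_eq_left mult_1)
      moreover have "1 / (1 + c) * c = 1 - 1 / (1 + c)" using c by (simp add: field_simps)
      ultimately show ?thesis by (simp add: scaleR_add_right)
    qed
    show "p \<in> X"
    \<comment> \<open>If \<open>p\<close> and \<open>q\<close> differ, \<open>x\<close> lies in the
      open segment between them and the face property applies; otherwise \<open>x\<close> is
      \<open>p\<close> itself.\<close>
    proof (cases "p = q")
      case True
      then have "x = p" using x_eq by (simp flip: scaleR_add_left)
      then show ?thesis using x(1) by simp
    next
      case False
      then have "x \<in> open_segment p q"
        unfolding in_segment using x_eq c by (intro conjI exI[of _ "1 / (1 + c)"]) auto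
      then show ?thesis using X p q x(1) unfolding face_of_def by blast
    qed
  qed
qed

text \<open>If every arc had positive flow at some point of \<open>X\<close>, the average of these
  points would have full support, and \<open>X\<close> would be the whole polytope, which is not a
  facet of itself.\<close>

lemma facet_of_flow_polytope_zero_coordinate:
  fixes G :: "('v, 'e::finite) pre_digraph"
  assumes X: "X facet_of flow_polytope G"
  shows "\<exists>e \<in> arcs G. \<forall>x \<in> X. x $ e = 0"
proof (rule ccontr)
  assume "\<not> ?thesis"
  then obtain y where y: "\<And>e. e \<in> arcs G \<Longrightarrow> y e \<in> X \<and> y e $ e \<noteq> 0"
    by metis
  have face: "X face_of flow_polytope G" using X by (rule facet_of_imp_face_of)
  then have sub: "X \<subseteq> flow_polytope G" by (rule face_of_imp_subset)
  then have pos: "0 \<le> x $ e" if "x \<in> X" "e \<in> arcs G" for x e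
    using that unfolding flow_polytope_def flow_cone_def by blast
  obtain x0 where "x0 \<in> X" using X unfolding facet_of_def by blast
  \<comment> \<open>Needed for the weights \<open>1 / card (arcs G)\<close> to sum to 1; it holds
    since the total outflow is 1.\<close>
  have "arcs G \<noteq> {}"
  proof
    assume "arcs G = {}"
    then have "out_arcs G v = {}" for v by auto
    then show False using \<open>x0 \<in> X\<close> sub unfolding flow_polytope_def by auto
  qed
  define x where "x = (\<Sum>e \<in> arcs G. (1 / card (arcs G)) *\<^sub>R y e)"
  have "x \<in> X"
    unfolding x_def using y \<open>arcs G \<noteq> {}\<close> face_of_imp_convex[OF face]
    by (intro convex_sum) auto
  moreover have "0 < x $ e" if "e \<in> arcs G" for e
  proof -
    have "0 < (1 / card (arcs G)) * y e $ e"
      using y[OF that] pos[of "y e" e] that \<open>arcs G \<noteq> {}\<close>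
      by (intro mult_pos_pos) (auto simp: card_gt_0_iff less_le)
    also have "\<dots> \<le> (\<Sum>d \<in> arcs G. (1 / card (arcs G)) * y d $ e)"
      using member_le_sum[of e "arcs G" "\<lambda>d. (1 / card (arcs G)) * y d $ e"] that y pos by simp
    finally show ?thesis unfolding x_def by simp
  qed
  ultimately have "X = flow_polytope G"
    using face face_of_flow_polytope_positive by blast
  then show False using X by (simp add: facet_of_def)
qed

section \<open>The special simplex\<close>

text \<open>If no exceptional route used \<open>e\<close>, all their vectors would lie in the face
  of the cone where \<open>e\<close> carries no flow. It is proper because some route uses
  \<open>e\<close>, so a facet contains it, against ampleness.\<close>

lemma ample_covers_arcs:
  fixes G :: "('v, 'e::finite) pre_digraph"
  assumes "dag G" "ample G F" "e \<in> arcs G"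
  shows "\<exists>R. exceptional G F R \<and> e \<in> set R"
proof (rule ccontr)
  assume none: "\<not> ?thesis"
  interpret acyclic_digraph G using dag_imp_acyclic_digraph[OF assms(1)] .
  let ?Y = "flow_cone G \<inter> {f. f $ e = 0}"
  have cone: "char_vec R \<in> flow_cone G" if "route G R" for R
    using char_vec_route_in_flow_polytope[OF assms(1) that] unfolding flow_polytope_def by simp
  have poly: "polyhedron (flow_cone G)"
    by (rule polyhedron_flow_cone) (rule fin_digraph_axioms)
  have "?Y face_of flow_cone G"
    using polyhedron_imp_convex[OF poly] assms(3)
    by (intro zero_coordinate_face_of) (auto simp: flow_cone_def)
  moreover have "0 \<in> ?Y" by (simp add: flow_cone_def)
  moreover have "?Y \<noteq> flow_cone G"
  proof -
    obtain A B where R: "route G (A @ [e] @ B)"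
      using awalk_extend_to_route[OF arc_implies_awalk[OF assms(3)]] by blast
    then have "char_vec (A @ [e] @ B) \<in> flow_cone G" by (rule cone)
    moreover have "char_vec (A @ [e] @ B) $ e = 1" by (simp add: char_vec_def)
    ultimately show ?thesis by force
  qed
  ultimately obtain X where "X facet_of flow_cone G" "?Y \<subseteq> X"
    using face_of_polyhedron_subset_facet[OF poly, of ?Y] by blast
  moreover have "char_vec ` {R. exceptional G F R} \<subseteq> ?Y"
    using none cone by (auto simp: exceptional_def char_vec_def)
  ultimately show False
    using assms(2) unfolding ample_def by blast
qed

text \<open>A point of the larger hull is a combination of \<open>v\<close>, with some weight
  \<open>u\<close>, and a point of the hull of \<open>W\<close>. Its coordinate \<open>e\<close> is
  \<open>u * v $ e\<close>, which vanishes only for \<open>u = 0\<close>.\<close>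

lemma convex_hull_insert_Int_zero_coordinate:
  fixes v :: "real ^ 'e::finite"
  assumes "W \<noteq> {}" "v $ e \<noteq> 0" "\<And>w. w \<in> W \<Longrightarrow> w $ e = 0"
  shows "convex hull (insert v W) \<inter> {x. x $ e = 0} = convex hull W"
proof -
  have "convex {x :: real ^ 'e. x $ e = 0}"
    using convex_hyperplane[of "axis e (1 :: real)" 0] by (simp add: inner_axis')
  then have *: "convex hull W \<subseteq> {x. x $ e = 0}"
    using assms(3) by (intro hull_minimal) auto
  have "convex hull W \<subseteq> convex hull (insert v W)"
    by (intro hull_mono) auto
  with * show ?thesis
    using assms(2) by (auto simp: convex_hull_insert[OF assms(1)])
qed

theorem theorem6p19:
  fixes G :: "('v, 'e::finite) pre_digraph" and F :: "('v, 'e) framing"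
  assumes "full_dag G" and "is_framing G F" and "ample G F"
  shows "special_simplex (flow_polytope G) (convex hull (char_vec ` {R. exceptional G F R}))"
proof -
  have dag: "dag G" using assms(1) unfolding full_dag_def by blast
  interpret framed_full_dag G F
    using dag_imp_acyclic_digraph[OF dag] assms(1,2)
    unfolding framed_full_dag_def framed_full_dag_axioms_def full_dag_def by blast
  let ?V = "char_vec ` {R. exceptional G F R} :: (real ^ 'e) set"
  let ?P = "flow_polytope G"
  have VP: "?V \<subseteq> ?P"
    using char_vec_route_in_flow_polytope[OF dag] by (auto simp: exceptional_def)
  have "pairwise orthogonal ?V"
  proof (rule pairwiseI)
    fix x y assume "x \<in> ?V" "y \<in> ?V" "x \<noteq> y"
    then obtain R R' where R: "exceptional G F R" "x = char_vec R" "exceptional G F R'"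
        "y = char_vec R'" "R \<noteq> R'"
      by blast
    then have "set R \<inter> set R' = {}" using exceptional_eqI by blast
    then show "orthogonal x y"
      unfolding R orthogonal_def inner_vec_def char_vec_def by (auto intro!: sum.neutral)
  qed
  \<comment> \<open>Orthogonality gives independence only for nonzero vectors; routes are nonempty
    lists.\<close>
  moreover have "0 \<notin> ?V"
  proof
    assume "0 \<in> ?V"
    then obtain R where "exceptional G F R" "char_vec R = 0" by force
    moreover have "char_vec R $ hd R = 1" if "R \<noteq> []" using that by (simp add: char_vec_def)
    ultimately show False by (auto simp: exceptional_def route_def)
  qed
  ultimately have "independent ?V"
    by (rule pairwise_orthogonal_independent)
  then have indep: "\<not> affine_dependent ?V"
    using affine_dependent_imp_dependent by blast
  then have "(int (card ?V) - 1) simplex (convex hull ?V)"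
    unfolding simplex_def by (intro exI[of _ ?V]) simp
  moreover have "x \<in> ?P \<and> lattice_point x" if "x extreme_point_of (convex hull ?V)" for x
  proof -
    have "x \<in> ?V" using extreme_point_of_convex_hull[OF that] .
    then show ?thesis using VP by (auto simp: lattice_point_def char_vec_def)
  qed
  moreover have "(X \<inter> convex hull ?V) facet_of (convex hull ?V)" if X: "X facet_of ?P" for X
  proof -
    have convex: "convex ?P"
      by (rule convex_flow_polytope) (rule fin_digraph_axioms)
    obtain e where e: "e \<in> arcs G" "\<And>x. x \<in> X \<Longrightarrow> x $ e = 0"
      using facet_of_flow_polytope_zero_coordinate[OF X] by blast
    obtain R where R: "exceptional G F R" "e \<in> set R"
      using ample_covers_arcs[OF dag assms(3) e(1)] by blast
    let ?v = "char_vec R :: real ^ 'e"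
    have v: "?v \<in> ?V" "?v $ e = 1" using R by (auto simp: char_vec_def)
    \<comment> \<open>\<open>X\<close> is a face of the proper face \<open>?Y\<close>. Were it
      different from \<open>?Y\<close>, the dimension would drop twice, but a facet has codimension
      one; hence \<open>X = ?Y\<close>.\<close>
    let ?Y = "?P \<inter> {x. x $ e = 0}"
    have Y: "?Y face_of ?P"
      using convex e(1)
      by (intro zero_coordinate_face_of) (auto simp: flow_polytope_def flow_cone_def)
    have "?Y \<noteq> ?P" using v VP by force
    then have "aff_dim ?Y < aff_dim ?P"
      by (rule face_of_aff_dim_lt[OF convex Y])
    moreover have "X face_of ?Y"
      using e(2) facet_of_imp_subset[OF X]
      by (intro face_of_subset[OF facet_of_imp_face_of[OF X]]) blast+
    ultimately have XY: "X = ?Y"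
      using face_of_aff_dim_lt[OF face_of_imp_convex[OF Y], of X] X unfolding facet_of_def
      by linarith
    \<comment> \<open>By arc-disjointness \<open>?v\<close> is the only vertex of the simplex off
      the hyperplane of \<open>X\<close>.\<close>
    let ?W = "?V - {?v}"
    have W: "w $ e = 0" if w: "w \<in> ?W" for w
    proof -
      obtain R' where R': "exceptional G F R'" "w = char_vec R'" "w \<noteq> ?v" using w by blast
      then have "e \<notin> set R'" using exceptional_eqI[OF R(1) R'(1) R(2)] by blast
      then show ?thesis using R'(2) by (simp add: char_vec_def)
    qed
    \<comment> \<open>A facet is nonempty by definition. If \<open>?v\<close> were the only vertex,
      \<open>R\<close> would cover all arcs, so \<open>e\<close> would be the only arc, and the
      points of \<open>X\<close> would have outflow 0 instead of 1.\<close>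
    have "?W \<noteq> {}"
    proof
      assume "?W = {}"
      then have only: "char_vec R' = ?v" if "exceptional G F R'" for R' using that by blast
      have "d \<in> set R" if d: "d \<in> arcs G" for d
      proof -
        obtain R' where R': "exceptional G F R'" "d \<in> set R'"
          using ample_covers_arcs[OF dag assms(3) d] by blast
        then have "?v $ d = 1" using only[OF R'(1), symmetric] by (simp add: char_vec_def)
        then show ?thesis by (simp add: char_vec_def split: if_splits)
      qed
      then obtain a where "R = [a]"
        using route_covering_arcs_singleton[of R] R(1) unfolding exceptional_def by blast
      then have arcs: "arcs G \<subseteq> {e}"
        using \<open>\<And>d. d \<in> arcs G \<Longrightarrow> d \<in> set R\<close> R(2) by auto
      obtain x where "x \<in> X" using X unfolding facet_of_def by blast
      then have "x \<in> ?P" "x $ e = 0" using XY by auto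
      then have "(\<Sum>v \<in> sources G. \<Sum>d \<in> out_arcs G v. x $ d) = 0"
        using arcs by (intro sum.neutral ballI) auto
      with \<open>x \<in> ?P\<close> show False
        unfolding flow_polytope_def by simp
    qed
    have "convex hull ?V \<subseteq> ?P"
      using VP convex by (rule hull_minimal)
    then have "X \<inter> convex hull ?V = convex hull (insert ?v ?W) \<inter> {x. x $ e = 0}"
      unfolding XY insert_Diff[OF v(1)] by blast
    also have "\<dots> = convex hull ?W"
      using \<open>?W \<noteq> {}\<close> v(2) W by (intro convex_hull_insert_Int_zero_coordinate) auto
    \<comment> \<open>The facets of a simplex are the nonempty hulls of all its vertices but
      one.\<close>
    finally show ?thesis
      using \<open>?W \<noteq> {}\<close> v(1) unfolding facet_of_convex_hull_affine_independent[OF indep] by auto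
  qed
  ultimately show ?thesis
    unfolding special_simplex_def by blast
qed

end
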